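(* Let $A$ be an ordered semiring, $Q$ an integral quantale, and $f\colon A\to Q$ a subadditive morphism, where $Q$ is regarded as the ordered semiring $(Q,\leq,\bot,1,\vee,\cdot)$. Then there exists a unique quantale homomorphism $g\colon \mathrm{Idl}(A)\to Q$ such that $g(\langle x\rangle)=f(x)$ for all $x\in A$, where $\mathrm{Idl}(A)$ is the integral quantale of ideals of $A$ and $\langle x\rangle$ is the ideal of $A$ generated by $x$.
   Context: Semirings are commutative and unital: $(A,0,+)$ and $(A,1,\cdot)$ are commutative monoids with $x\cdot 0=0$ and $x(y+z)=xy+xz$. An ordered semiring is a tuple $(A,\leq,0,1,+,\cdot)$ where $(A,0,1,+,\cdot)$ is a semiring and $\leq$ is a preorder on $A$ with respect to which $+$ and $\cdot$ are monotone. A subadditive morphism $f\colon A\to B$ between ordered semirings is a monotone function with $f(0_A)\leq 0_B$, $f(1_A)=1_B$, $f(x+y)\leq f(x)+f(y)$ and $f(xy)=f(x)f(y)$ for all $x,y\in A$. A quantale (always unital and commutative) is a tuple $(Q,\leq,1,\cdot)$ where $(Q,\leq)$ is a complete lattice (poset), $(Q,1,\cdot)$ is a commutative monoid, and $x\cdot\bigvee_\lambda y_\lambda=\bigvee_\lambda x\cdot y_\lambda$ for all families $(y_\lambda)$ in $Q$. It is integral if $1$ is the largest element. A quantale homomorphism is a function preserving arbitrary joins, the unit and the multiplication. Any quantale $Q$ is regarded as an ordered semiring $(Q,\leq,\bot,1,\vee,\cdot)$. An ideal of an ordered semiring $A$ is a subset $I\subseteq A$ such that: $x\leq y\in I$ implies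 $x\in I$; $0\in I$; $x,y\in I$ implies $x+y\in I$; and if $x\in I$ or $y\in I$ then $xy\in I$. For $S\subseteq A$, $\langle S\rangle$ denotes the smallest ideal containing $S$, and $\langle x\rangle=\langle\{x\}\rangle$. $\mathrm{Idl}(A)$ is the set of all ideals of $A$; ordered by inclusion, with multiplication $I\cdot J=\langle\{xy\mid x\in I,y\in J\}\rangle$ and unit $A$, it is an integral quantale. *)

theory Defs
  imports Main
begin

section \<open>Ordered semirings\<close>

text \<open>Ordered semirings as explicit tuples. The order is only a preorder, and \<open>0 = 1\<close> is allowed.
  The explicit operations are needed because a quantale type carries its semiring structure
  \<open>(\<le>, \<bottom>, 1, \<squnion>, \<cdot>)\<close> under other names than those of the arithmetic type classes.\<close>

locale ordered_csemiring =
  add: comm_monoid add zero + mult: comm_monoid mult one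
  for le :: "'a \<Rightarrow> 'a \<Rightarrow> bool"
    and zero one :: 'a
    and add mult :: "'a \<Rightarrow> 'a \<Rightarrow> 'a" +
  assumes mult_zero: "mult x zero = zero"
    and distrib: "mult x (add y z) = add (mult x y) (mult x z)"
    and le_refl: "le x x"
    and le_trans: "le x y \<Longrightarrow> le y z \<Longrightarrow> le x z"
    and add_mono: "le x x' \<Longrightarrow> le y y' \<Longrightarrow> le (add x y) (add x' y')"
    and mult_mono: "le x x' \<Longrightarrow> le y y' \<Longrightarrow> le (mult x y) (mult x' y')"

text \<open>The same notion as a type class. Neither \<open>comm_semiring_1\<close> (which demands \<open>0 \<noteq> 1\<close>) nor
  \<open>ordered_semiring\<close> (which demands a partial order) can be used.\<close>

class preordered_csemiring = comm_semiring_0 + comm_monoid_mult + preorder +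
  assumes plus_mono: "x \<le> x' \<Longrightarrow> y \<le> y' \<Longrightarrow> x + y \<le> x' + y'"
    and times_mono: "x \<le> x' \<Longrightarrow> y \<le> y' \<Longrightarrow> x * y \<le> x' * y'"

lemma ordered_csemiring_class:
  "ordered_csemiring (\<le>) (0 :: 'a :: preordered_csemiring) 1 (+) (*)"
  by unfold_locales (auto simp: distrib_left intro: order_trans plus_mono times_mono)

locale subadditive_morphism =
  A: ordered_csemiring leA zeroA oneA addA multA + B: ordered_csemiring leB zeroB oneB addB multB
  for leA :: "'a \<Rightarrow> 'a \<Rightarrow> bool" and zeroA oneA addA multA
    and leB :: "'b \<Rightarrow> 'b \<Rightarrow> bool" and zeroB oneB addB multB +
  fixes f :: "'a \<Rightarrow> 'b"
  assumes mono: "leA x y \<Longrightarrow> leB (f x) (f y)"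
    and zero: "leB (f zeroA) zeroB"
    and one: "f oneA = oneB"
    and add: "leB (f (addA x y)) (addB (f x) (f y))"
    and mult: "f (multA x y) = multB (f x) (f y)"


section \<open>Quantales\<close>

class quantale = complete_lattice + comm_monoid_mult +
  assumes mult_Sup: "x * Sup Y = (SUP y\<in>Y. x * y)"

class integral_quantale = quantale +
  assumes le_one: "x \<le> 1"

lemma quantale_mult_sup: "(x :: 'q :: quantale) * sup y z = sup (x * y) (x * z)"
  using mult_Sup[of x "{y, z}"] by simp

lemma quantale_mult_mono:
  fixes x :: "'q :: quantale"
  assumes "x \<le> x'" "y \<le> y'"
  shows "x * y \<le> x' * y'"
proof -
  have *: "a * b \<le> a * b'" if "b \<le> b'" for a b b' :: 'q
    using quantale_mult_sup[of a b b'] that by (metis sup.absorb2 sup_ge1)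
  from *[OF assms(2)] have "x * y \<le> x * y'" .
  also have "\<dots> \<le> x' * y'" using *[OF assms(1), of y'] by (simp add: mult.commute)
  finally show ?thesis .
qed

lemma ordered_csemiring_quantale:
  "ordered_csemiring (\<le>) (bot :: 'q :: quantale) 1 sup (*)"
proof
  show "x * bot = bot" for x :: 'q using mult_Sup[of x "{}"] by simp
qed (auto simp: quantale_mult_sup ac_simps intro: order_trans quantale_mult_mono le_supI1 le_supI2)

definition quantale_hom :: "('p :: quantale \<Rightarrow> 'q :: quantale) \<Rightarrow> bool" where
  "quantale_hom g \<longleftrightarrow>
     (\<forall>Y. g (Sup Y) = (SUP y\<in>Y. g y)) \<and> g 1 = 1 \<and> (\<forall>x y. g (x * y) = g x * g y)"


section \<open>The quantale of ideals\<close>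

definition is_ideal :: "'a :: preordered_csemiring set \<Rightarrow> bool" where
  "is_ideal I \<longleftrightarrow>
     (\<forall>x y. x \<le> y \<and> y \<in> I \<longrightarrow> x \<in> I) \<and>
     0 \<in> I \<and>
     (\<forall>x y. x \<in> I \<and> y \<in> I \<longrightarrow> x + y \<in> I) \<and>
     (\<forall>x y. x \<in> I \<or> y \<in> I \<longrightarrow> x * y \<in> I)"

lemma is_ideal_UNIV: "is_ideal UNIV"
  by (simp add: is_ideal_def)

lemma is_ideal_Inter: "(\<And>I. I \<in> F \<Longrightarrow> is_ideal I) \<Longrightarrow> is_ideal (\<Inter>F)"
  unfolding is_ideal_def by blast

typedef (overloaded) 'a ideal = "{I :: 'a :: preordered_csemiring set. is_ideal I}"
  morphisms elements Ideal
  using is_ideal_UNIV by blast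

definition ideal_gen :: "'a :: preordered_csemiring set \<Rightarrow> 'a ideal" where
  "ideal_gen S = Ideal (\<Inter>{I. is_ideal I \<and> S \<subseteq> I})"

lemma is_ideal_elements: "is_ideal (elements I)"
  using elements by blast

lemma elements_ideal_gen: "elements (ideal_gen S) = \<Inter>{I. is_ideal I \<and> S \<subseteq> I}"
  unfolding ideal_gen_def by (rule Ideal_inverse) (auto intro: is_ideal_Inter)

lemma elements_ideal_gen_subset_iff: "elements (ideal_gen S) \<subseteq> elements I \<longleftrightarrow> S \<subseteq> elements I"
  using is_ideal_elements[of I] by (auto simp: elements_ideal_gen)

lemma ideal_gen_superset: "S \<subseteq> elements (ideal_gen S)"
  by (auto simp: elements_ideal_gen)

instantiation ideal :: (preordered_csemiring) complete_lattice
begin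

definition less_eq_ideal where "I \<le> J \<longleftrightarrow> elements I \<subseteq> elements J"
definition less_ideal where "I < J \<longleftrightarrow> elements I \<subset> elements J"
definition Inf_ideal where "Inf F = Ideal (\<Inter>I\<in>F. elements I)"
definition Sup_ideal where "Sup F = ideal_gen (\<Union>I\<in>F. elements I)"
definition inf_ideal where "inf I J = Ideal (elements I \<inter> elements J)"
definition sup_ideal where "sup I J = ideal_gen (elements I \<union> elements J)"
definition bot_ideal :: "'a ideal" where "bot = ideal_gen {}"
definition top_ideal :: "'a ideal" where "top = Ideal UNIV"

lemma elements_Inf: "elements (Inf F) = (\<Inter>I\<in>F. elements I)"
  unfolding Inf_ideal_def by (rule Ideal_inverse) (auto intro: is_ideal_Inter is_ideal_elements)

lemma elements_inf: "elements (inf I J) = elements I \<inter> elements J"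
proof -
  have "is_ideal (\<Inter>{elements I, elements J})"
    by (rule is_ideal_Inter) (auto simp: is_ideal_elements)
  then show ?thesis by (simp add: inf_ideal_def Ideal_inverse)
qed

lemma ideal_gen_le_iff: "ideal_gen S \<le> I \<longleftrightarrow> S \<subseteq> elements I"
  by (simp add: less_eq_ideal_def elements_ideal_gen_subset_iff)

instance
proof
  fix I J K :: "'a ideal" and F :: "'a ideal set"
  show "I < J \<longleftrightarrow> I \<le> J \<and> \<not> J \<le> I" by (auto simp: less_eq_ideal_def less_ideal_def)
  show "I \<le> I" by (simp add: less_eq_ideal_def)
  show "I \<le> J \<Longrightarrow> J \<le> K \<Longrightarrow> I \<le> K" by (auto simp: less_eq_ideal_def)
  show "I \<le> J \<Longrightarrow> J \<le> I \<Longrightarrow> I = J" by (simp add: less_eq_ideal_def flip: elements_inject)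
  show "inf I J \<le> I" "inf I J \<le> J" by (auto simp: less_eq_ideal_def elements_inf)
  show "I \<le> J \<Longrightarrow> I \<le> K \<Longrightarrow> I \<le> inf J K" by (auto simp: less_eq_ideal_def elements_inf)
  show "I \<le> sup I J" "J \<le> sup I J"
    using ideal_gen_superset[of "elements I \<union> elements J"]
    by (auto simp: less_eq_ideal_def sup_ideal_def)
  show "J \<le> I \<Longrightarrow> K \<le> I \<Longrightarrow> sup J K \<le> I"
    by (simp add: sup_ideal_def ideal_gen_le_iff) (simp add: less_eq_ideal_def)
  show "I \<in> F \<Longrightarrow> Inf F \<le> I" by (auto simp: less_eq_ideal_def elements_Inf)
  show "(\<And>J. J \<in> F \<Longrightarrow> I \<le> J) \<Longrightarrow> I \<le> Inf F"
    by (auto simp: less_eq_ideal_def elements_Inf)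
  show "I \<in> F \<Longrightarrow> I \<le> Sup F"
    using ideal_gen_superset[of "\<Union>I\<in>F. elements I"]
    by (auto simp: less_eq_ideal_def Sup_ideal_def)
  show "(\<And>J. J \<in> F \<Longrightarrow> J \<le> I) \<Longrightarrow> Sup F \<le> I"
    by (simp add: Sup_ideal_def ideal_gen_le_iff) (auto simp: less_eq_ideal_def)
  show "Inf {} = (top :: 'a ideal)" by (simp add: Inf_ideal_def top_ideal_def)
  show "Sup {} = (bot :: 'a ideal)" by (simp add: Sup_ideal_def bot_ideal_def)
qed

end

instantiation ideal :: (preordered_csemiring) "{one, times}"
begin

definition one_ideal :: "'a ideal" where "1 = Ideal UNIV"
definition times_ideal where "I * J = ideal_gen {x * y | x y. x \<in> elements I \<and> y \<in> elements J}"

instance ..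

end

lemma elements_one: "elements 1 = UNIV"
  unfolding one_ideal_def by (rule Ideal_inverse) (simp add: is_ideal_UNIV)

lemma is_ideal_residual:
  assumes "is_ideal L"
  shows "is_ideal {x. \<forall>z\<in>K. x * z \<in> L}"
proof -
  have "x * y * z \<in> L" if "(\<forall>z\<in>K. x * z \<in> L) \<or> (\<forall>z\<in>K. y * z \<in> L)" "z \<in> K" for x y z
  proof -
    have "x * y * z = y * (x * z)" "x * y * z = x * (y * z)" by (simp_all add: ac_simps)
    then show ?thesis using that assms unfolding is_ideal_def by metis
  qed
  moreover have "x * z \<in> L" if "x \<le> y" "\<forall>z\<in>K. y * z \<in> L" "z \<in> K" for x y z
    using that assms times_mono[OF \<open>x \<le> y\<close> order_refl[of z]] unfolding is_ideal_def by blast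
  ultimately show ?thesis
    using assms unfolding is_ideal_def by (auto simp: distrib_right)
qed

lemma times_ideal_le_iff:
  "I * J \<le> L \<longleftrightarrow> (\<forall>x\<in>elements I. \<forall>y\<in>elements J. x * y \<in> elements L)"
  by (auto simp: times_ideal_def ideal_gen_le_iff)

lemma ideal_gen_times_le_iff:
  "ideal_gen S * J \<le> L \<longleftrightarrow> (\<forall>x\<in>S. \<forall>y\<in>elements J. x * y \<in> elements L)"
proof
  show "ideal_gen S * J \<le> L \<Longrightarrow> \<forall>x\<in>S. \<forall>y\<in>elements J. x * y \<in> elements L"
    using ideal_gen_superset[of S] by (auto simp: times_ideal_le_iff)
next
  let ?R = "{x. \<forall>y\<in>elements J. x * y \<in> elements L}"
  assume "\<forall>x\<in>S. \<forall>y\<in>elements J. x * y \<in> elements L"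
  moreover have "is_ideal ?R" by (intro is_ideal_residual is_ideal_elements)
  ultimately have "elements (ideal_gen S) \<subseteq> ?R" by (auto simp: elements_ideal_gen)
  then show "ideal_gen S * J \<le> L" by (auto simp: times_ideal_le_iff)
qed

instance ideal :: (preordered_csemiring) integral_quantale
proof
  fix I J K :: "'a ideal" and F :: "'a ideal set"
  show comm: "I * J = J * I" for I J :: "'a ideal"
  proof -
    have "I * J \<le> J * I" for I J :: "'a ideal"
    proof -
      have "\<forall>y\<in>elements J. \<forall>x\<in>elements I. y * x \<in> elements (J * I)"
        unfolding times_ideal_le_iff[symmetric] by (rule order_refl)
      then have "x * y \<in> elements (J * I)" if "x \<in> elements I" "y \<in> elements J" for x y
        using that by (subst mult.commute) blast
      then show ?thesis by (simp add: times_ideal_le_iff)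
    qed
    then show ?thesis by (blast intro: order_antisym)
  qed
  have assoc_le_iff: "I * J * K \<le> L \<longleftrightarrow>
      (\<forall>x\<in>elements I. \<forall>y\<in>elements J. \<forall>z\<in>elements K. x * y * z \<in> elements L)"
    for I J K L :: "'a ideal"
    by (subst times_ideal_def) (auto simp: ideal_gen_times_le_iff)
  have swap: "x * y * z = y * z * x" for x y z :: 'a
    by (simp add: ac_simps)
  have "I * J * K \<le> L \<longleftrightarrow> J * K * I \<le> L" for L
    unfolding assoc_le_iff by (subst swap) blast
  then have "I * J * K = J * K * I" by (blast intro: order_antisym)
  then show "I * J * K = I * (J * K)" using comm[of I "J * K"] by simp
  show "1 * I = I"
  proof (rule order_antisym)
    show "1 * I \<le> I"
      using is_ideal_elements[of I] by (auto simp: times_ideal_le_iff is_ideal_def)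
    have "\<forall>x\<in>elements 1. \<forall>y\<in>elements I. x * y \<in> elements (1 * I)"
      unfolding times_ideal_le_iff[symmetric] by (rule order_refl)
    then have "1 * x \<in> elements (1 * I)" if "x \<in> elements I" for x
      using that unfolding elements_one by blast
    then show "I \<le> 1 * I" by (auto simp: less_eq_ideal_def)
  qed
  show "I \<le> 1" by (simp add: less_eq_ideal_def elements_one)
  have "Sup F * I \<le> L \<longleftrightarrow> (SUP J\<in>F. J * I) \<le> L" for L
    unfolding Sup_ideal_def[of F] ideal_gen_times_le_iff
    unfolding SUP_le_iff times_ideal_le_iff by blast
  then have "Sup F * I = (SUP J\<in>F. J * I)" by (blast intro: order_antisym)
  then show "I * Sup F = (SUP J\<in>F. I * J)" by (simp add: comm)
qed

end

theory Submission
  imports Defs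
begin

text \<open>The extension is \<open>g I = (SUP x\<in>I. f x)\<close>. Subadditivity of \<open>f\<close> and integrality of \<open>Q\<close> make
  every sublevel set \<open>{x. f x \<le> q}\<close> an ideal, so the supremum of \<open>f\<close> over a generated ideal is its
  supremum over the generators; this gives the value on principal ideals and the preservation of
  joins and products. Uniqueness holds because every ideal is the join of its principal subideals.\<close>

text \<open>Each \<open>x\<close> in \<open>I\<close> lies in its own principal ideal, and that
  ideal is contained in \<open>I\<close>.\<close>

lemma ideal_eq_Sup_principal: "(I :: 'a :: preordered_csemiring ideal) = (SUP x\<in>elements I. ideal_gen {x})"
proof (rule order_antisym)
  have "ideal_gen {x} \<le> (SUP x\<in>elements I. ideal_gen {x})" if "x \<in> elements I" for x
    using that by (rule SUP_upper)
  then show "I \<le> (SUP x\<in>elements I. ideal_gen {x})"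
    by (auto simp: less_eq_ideal_def elements_ideal_gen_subset_iff)
  show "(SUP x\<in>elements I. ideal_gen {x}) \<le> I"
    by (simp add: SUP_le_iff ideal_gen_le_iff)
qed

lemma mult_SUP_SUP:
  fixes f :: "'a \<Rightarrow> 'q :: quantale"
  shows "(SUP x\<in>X. f x) * (SUP y\<in>Y. h y) = (SUP x\<in>X. SUP y\<in>Y. f x * h y)"
proof -
  have "(SUP x\<in>X. f x) * q = (SUP x\<in>X. f x * q)" for q
    using mult_Sup[of q "f ` X"] by (simp add: mult.commute image_image)
  moreover have "q * (SUP y\<in>Y. h y) = (SUP y\<in>Y. q * h y)" for q
    by (simp add: mult_Sup image_image)
  \<comment> \<open>Distributing over the right factor first puts the supremum over \<open>Y\<close>
    outermost; the right-hand side is swapped to match.\<close>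
  ultimately show ?thesis by (subst SUP_commute) simp
qed

context
  fixes f :: "'a :: preordered_csemiring \<Rightarrow> 'q :: integral_quantale"
  assumes f: "subadditive_morphism (\<le>) 0 1 (+) (*) (\<le>) bot 1 sup (*) f"
begin

interpretation f: subadditive_morphism "(\<le>)" "0 :: 'a" 1 "(+)" "(*)" "(\<le>)" "bot :: 'q" 1 sup "(*)" f
  by (rule f)

lemma is_ideal_sublevel: "is_ideal {x. f x \<le> q}"
proof -
  \<comment> \<open>Integrality: the other factor is at most \<open>1\<close>, so a product lies
    below each factor.\<close>
  have "f x * f y \<le> q" if "f x \<le> q \<or> f y \<le> q" for x y
    using that quantale_mult_mono[OF _ le_one, of "f x" q "f y"]
      quantale_mult_mono[OF le_one, of "f y" q "f x"] by auto
  moreover have "f (x + y) \<le> q" if "f x \<le> q" "f y \<le> q" for x y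
    using f.add[of x y] that by (meson order_trans sup_least)
  moreover have "f 0 \<le> q"
    using f.zero by (simp add: bot_unique)
  ultimately show ?thesis
    unfolding is_ideal_def by (auto simp: f.mult intro: order_trans f.mono)
qed

definition ideal_ext :: "'a ideal \<Rightarrow> 'q" where
  "ideal_ext I = (SUP x\<in>elements I. f x)"

lemma ideal_ext_gen: "ideal_ext (ideal_gen S) = (SUP x\<in>S. f x)"
proof (rule order_antisym)
  \<comment> \<open>The sublevel set at the supremum over the generators is an ideal containing
    \<open>S\<close>, hence contains all of \<open>ideal_gen S\<close>.\<close>
  let ?R = "{x. f x \<le> (SUP x\<in>S. f x)}"
  have "S \<subseteq> ?R" by (auto intro: SUP_upper)
  then have "elements (ideal_gen S) \<subseteq> ?R"
    using is_ideal_sublevel by (auto simp: elements_ideal_gen)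
  then show "ideal_ext (ideal_gen S) \<le> (SUP x\<in>S. f x)"
    by (auto simp: ideal_ext_def SUP_le_iff)
  show "(SUP x\<in>S. f x) \<le> ideal_ext (ideal_gen S)"
    unfolding ideal_ext_def by (rule SUP_subset_mono[OF ideal_gen_superset order_refl])
qed

lemma quantale_hom_ideal_ext: "quantale_hom ideal_ext"
  unfolding quantale_hom_def
proof (intro conjI allI)
  show "ideal_ext (Sup F) = (SUP I\<in>F. ideal_ext I)" for F
    unfolding Sup_ideal_def ideal_ext_gen by (simp add: ideal_ext_def SUP_UNION)
  \<comment> \<open>The unit ideal contains \<open>1\<close>, and \<open>f 1 = 1\<close> is already
    the top of the quantale.\<close>
  have "f 1 \<le> ideal_ext 1"
    unfolding ideal_ext_def by (rule SUP_upper) (simp add: elements_one)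
  then show "ideal_ext 1 = 1"
    using le_one by (auto simp: f.one intro: order_antisym)
  show "ideal_ext (I * J) = ideal_ext I * ideal_ext J" for I J
  proof -
    \<comment> \<open>As a union of images, the generating set yields an iterated supremum, which
      \<open>mult_SUP_SUP\<close> factors once \<open>f\<close> is multiplicative.\<close>
    have "{x * y | x y. x \<in> elements I \<and> y \<in> elements J} = (\<Union>x\<in>elements I. (*) x ` elements J)"
      by auto
    then show ?thesis
      unfolding times_ideal_def ideal_ext_gen
      by (simp add: ideal_ext_def mult_SUP_SUP SUP_UNION image_image f.mult)
  qed
qed

lemma quantale_hom_eq_ideal_ext:
  assumes "quantale_hom g" "\<And>x. g (ideal_gen {x}) = f x"
  shows "g = ideal_ext"
proof
  fix I
  have "g I = g (SUP x\<in>elements I. ideal_gen {x})"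
    by (simp flip: ideal_eq_Sup_principal)
  \<comment> \<open>Join preservation moves \<open>g\<close> inside, onto principal ideals, where it
    agrees with \<open>f\<close>.\<close>
  also have "\<dots> = ideal_ext I"
    using assms by (simp add: quantale_hom_def ideal_ext_def image_image)
  finally show "g I = ideal_ext I" .
qed

end

theorem theorem4p4:
  fixes f :: "'a :: preordered_csemiring \<Rightarrow> 'q :: integral_quantale"
  assumes "subadditive_morphism (\<le>) 0 1 (+) (*) (\<le>) bot 1 sup (*) f"
  shows "\<exists>!g :: 'a ideal \<Rightarrow> 'q. quantale_hom g \<and> (\<forall>x. g (ideal_gen {x}) = f x)"
proof (rule ex1I)
  show "quantale_hom (ideal_ext f) \<and> (\<forall>x. ideal_ext f (ideal_gen {x}) = f x)"
    using assms by (simp add: quantale_hom_ideal_ext ideal_ext_gen)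
  show "g = ideal_ext f" if "quantale_hom g \<and> (\<forall>x. g (ideal_gen {x}) = f x)" for g
    using that assms by (blast intro: quantale_hom_eq_ideal_ext)
qed

end
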